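(* Let $a_1\le a_2\le a_3\le a_4\le a_5$ be positive integers with $\sum_{i=1}^5 \frac1{a_i}=1$, let $W=\sum_{i=1}^5 x_i^{a_i}$, and let $G$ be any subgroup with $G_0\subset G\subset G^{\max}$, with mirror dual group $G^T$. Let $\chi(\widetilde{W/G})$ be the Euler characteristic given by the Vafa formula $$\chi(\widetilde{W/G})=\frac1{|G|}\sum_{(g,h)\in G\times G}\ \prod_{i\in\{1,\dots,5\}:\ g_i=h_i=0}(1-a_i)$$ (elements of $G$ are written in fractional coordinates, so the $i$-th coordinate $0$ corresponds to the $i$-th diagonal entry $1$; the empty product is $1$). Let $h^{2,1}(\widetilde{W/G})$ and $h^{2,1}(\widetilde{W/G^T})$ be Roan's Hodge numbers, $$h^{2,1}(\widetilde{W/G})=|S^G|+|\{(G^T,G)\text{-Roan pairs}\}|,\qquad h^{2,1}(\widetilde{W/G^T})=|S^{G^T}|+|\{(G,G^T)\text{-Roan pairs}\}|.$$ Then $$\tfrac12\,\chi(\widetilde{W/G})=h^{2,1}(\widetilde{W/G^T})-h^{2,1}(\widetilde{W/G}).$$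
   Context: Fix positive integers $a_1\le\dots\le a_5$ with $\sum_i 1/a_i=1$. Groups. $G^{\max}$ is the finite abelian group of diagonal symmetries of $W=\sum x_i^{a_i}$ of determinant $1$. Elements are written in fractional coordinates: $G^{\max}$ is identified with the set of vectors $g=(g_1,\dots,g_5)$ with $g_i\in\{0,\frac1{a_i},\dots,\frac{a_i-1}{a_i}\}$ and $\sum_i g_i\in\mathbb Z$, with coordinatewise addition modulo $1$; $g$ corresponds to the diagonal matrix with entries $\exp(2\pi\sqrt{-1}\,g_i)$. $G_0\subset G^{\max}$ is the cyclic subgroup generated by $(\frac1{a_1},\dots,\frac1{a_5})$ (its order is $d=\mathrm{lcm}(a_1,\dots,a_5)$). Mirror dual group. For $G_0\subset G\subset G^{\max}$, $G^T=\{g'\in G^{\max}: \sum_i g_i a_i g'_i\in\mathbb Z \text{ for all } g\in G\}$; again $G_0\subset G^T\subset G^{\max}$. Level. An element $g$ (with coordinates in $[0,1)$) has level $k$ if $\sum_i g_i=k$ (sum in $\mathbb Q$). Invariant deformations. $S^G$ is the set of $S\in\mathbb Z^5$ with $0\le S_i\le a_i-2$ for all $i$, $\sum_i \frac{S_i}{a_i}=1$, and $(\frac{S_1}{a_1},\dots,\frac{S_5}{a_5})\in G^T$ (exponents of $G$-invariant monomial deformations). $S^{G^T}$ is defined by exchanging the roles of $G$ and $G^T$, i.e. with the condition $(\frac{S_1}{a_1},\dots,\frac{S_5}{a_5})\in G$. Roan pairs. For a subgroup $H$ of $G^{\max}$, $H_{2Z}$ (resp. $H_{3Z}$) is the set of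 level one elements of $H$ having exactly two (resp. exactly three) zero coordinates. A $(G^T,G)$-Roan pair is a pair $(\mathbf z',\mathbf z)\in G^T_{2Z}\times G_{3Z}$ with $\sum_i z'_i a_i z_i=0$. A $(G,G^T)$-Roan pair is a pair $(\mathbf z,\mathbf z')\in G_{2Z}\times G^T_{3Z}$ with $\sum_i z_i a_i z'_i=0$. (Coordinates taken in $[0,1)$, sums in $\mathbb Q$.) *)

theory Defs
  imports Complex_Main "HOL-Library.FuncSet" "HOL-Algebra.Generated_Groups"
begin

text \<open>
  The Fermat polynomial \<open>W = x\<^sub>1\<^bsup>a\<^sub>1\<^esup> + \<dots> + x\<^sub>5\<^bsup>a\<^sub>5\<^esup>\<close> enters only through its exponents
  \<open>a :: nat \<Rightarrow> nat\<close>, read on \<open>{1..5}\<close>. Vectors are extensional functions on \<open>{1..5}\<close>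
  (value \<^term>\<open>undefined\<close> elsewhere), so that the sets below have the right cardinality.
  Group elements are in fractional coordinates: \<open>g\<close> stands for the diagonal matrix with entries
  \<open>exp (2\<pi>\<i> g\<^sub>i)\<close>; it preserves \<open>W\<close> since \<open>g\<^sub>i \<in> (1/a\<^sub>i)\<int>\<close>, and has determinant 1 since the
  coordinates sum to an integer.
\<close>

definition Gmax :: "(nat \<Rightarrow> nat) \<Rightarrow> (nat \<Rightarrow> rat) monoid" where
  "Gmax a =
    \<lparr>carrier = {g \<in> (\<Pi>\<^sub>E i\<in>{1..5}. {of_nat k / of_nat (a i) | k. k < a i}).
                 (\<Sum>i\<in>{1..5}. g i) \<in> \<int>},
     monoid.mult = (\<lambda>g h. \<lambda>i\<in>{1..5}. frac (g i + h i)),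
     one = (\<lambda>i\<in>{1..5}. 0)\<rparr>"

lemma comm_group_Gmax:
  assumes a: "\<forall>i\<in>{1..5}. a i > 0"
  shows "comm_group (Gmax a)"
proof -
  define D :: "nat \<Rightarrow> rat set" where "D = (\<lambda>i. {of_nat k / of_nat (a i) | k. k < a i})"
  have carrier_D: "carrier (Gmax a) = {g \<in> (\<Pi>\<^sub>E i\<in>{1..5}. D i). (\<Sum>i\<in>{1..5}. g i) \<in> \<int>}"
    by (simp add: Gmax_def D_def)
  have D_iff: "x \<in> D i \<longleftrightarrow> 0 \<le> x \<and> x < 1 \<and> x * of_nat (a i) \<in> \<int>" if i: "i \<in> {1..5}" for x i
  proof
    assume "x \<in> D i"
    then show "0 \<le> x \<and> x < 1 \<and> x * of_nat (a i) \<in> \<int>"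
      by (auto simp: D_def)
  next
    assume x: "0 \<le> x \<and> x < 1 \<and> x * of_nat (a i) \<in> \<int>"
    then obtain m where m: "x * of_nat (a i) = of_int m" by (auto elim: Ints_cases)
    have ai: "(of_nat (a i) :: rat) > 0" using a i by auto
    have "(0::rat) \<le> of_int m" using x ai by (metis m mult_nonneg_nonneg less_imp_le)
    then have m0: "m \<ge> 0" by simp
    have "(of_int m :: rat) < of_nat (a i)"
      using x ai unfolding m[symmetric] by (simp add: mult_less_cancel_right1)
    then have "m < int (a i)" by linarith
    then have "nat m < a i" using m0 by linarith
    moreover have "x = of_nat (nat m) / of_nat (a i)"
      using m ai m0 by (simp add: field_simps)
    ultimately show "x \<in> D i" unfolding D_def by blast
  qed
  have fracD: "frac x \<in> D i" if "i \<in> {1..5}" "x * of_nat (a i) \<in> \<int>" for x i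
  proof -
    have "frac x * of_nat (a i) \<in> \<int>" using that(2) by (simp add: frac_def left_diff_distrib)
    then show ?thesis using D_iff[OF that(1)] frac_lt_1[of x] frac_ge_0[of x] by blast
  qed
  have frac_sum: "(\<Sum>i\<in>{1..5}. frac (f i)) \<in> \<int>" if "(\<Sum>i\<in>{1..5}. f i) \<in> \<int>"
    for f :: "nat \<Rightarrow> rat"
    using that by (simp add: frac_def sum_subtractf flip: of_int_sum)
  have memD: "g i \<in> D i" if "g \<in> carrier (Gmax a)" "i \<in> {1..5}" for g i
    using that unfolding carrier_D by auto
  have add_Int: "(g i + h i) * of_nat (a i) \<in> \<int>"
    if "g \<in> carrier (Gmax a)" "h \<in> carrier (Gmax a)" "i \<in> {1..5}" for g h i
    using memD[OF that(1,3)] memD[OF that(2,3)] D_iff[OF that(3)] by (simp add: distrib_right)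
  have frac_id: "frac (g i) = g i" if "g \<in> carrier (Gmax a)" "i \<in> {1..5}" for g i
    using memD[OF that] D_iff[OF that(2)] by (simp add: frac_eq)
  have frac_add: "frac (frac x + y) = frac (x + y)" "frac (x + frac y) = frac (x + y)"
    for x y :: rat
    using floor_diff_of_int[of "x + y" "\<lfloor>x\<rfloor>"] floor_diff_of_int[of "x + y" "\<lfloor>y\<rfloor>"]
    by (simp_all add: frac_def algebra_simps)
  have carrierI: "(\<lambda>i\<in>{1..5}. frac (f i)) \<in> carrier (Gmax a)"
    if "\<And>i. i \<in> {1..5} \<Longrightarrow> f i * of_nat (a i) \<in> \<int>" "(\<Sum>i\<in>{1..5}. f i) \<in> \<int>" for f
    using fracD that frac_sum[of f] unfolding carrier_D by auto
  have sumD: "(\<Sum>i\<in>{1..5}. g i) \<in> \<int>" and extD: "g \<in> extensional {1..5}"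
    if "g \<in> carrier (Gmax a)" for g
    using that unfolding carrier_D by (auto simp: PiE_def)
  show ?thesis
  proof (rule comm_groupI)
    fix g h assume gh: "g \<in> carrier (Gmax a)" "h \<in> carrier (Gmax a)"
    show "g \<otimes>\<^bsub>Gmax a\<^esub> h \<in> carrier (Gmax a)"
      using carrierI[of "\<lambda>i. g i + h i"] add_Int[OF gh] sumD[OF gh(1)] sumD[OF gh(2)]
      by (simp add: Gmax_def sum.distrib)
    show "g \<otimes>\<^bsub>Gmax a\<^esub> h = h \<otimes>\<^bsub>Gmax a\<^esub> g" by (simp add: Gmax_def add.commute)
  next
    show "\<one>\<^bsub>Gmax a\<^esub> \<in> carrier (Gmax a)"
      using carrierI[of "\<lambda>_. 0"] by (simp add: Gmax_def)
  next
    fix g h k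
    show "g \<otimes>\<^bsub>Gmax a\<^esub> h \<otimes>\<^bsub>Gmax a\<^esub> k = g \<otimes>\<^bsub>Gmax a\<^esub> (h \<otimes>\<^bsub>Gmax a\<^esub> k)"
      by (auto simp: Gmax_def frac_add add.assoc intro!: restrict_ext)
  next
    fix g assume g: "g \<in> carrier (Gmax a)"
    show "\<one>\<^bsub>Gmax a\<^esub> \<otimes>\<^bsub>Gmax a\<^esub> g = g"
      using frac_id[OF g] extD[OF g] by (auto simp: Gmax_def extensional_def fun_eq_iff)
    let ?h = "\<lambda>i\<in>{1..5}. frac (- g i)"
    have "?h \<in> carrier (Gmax a)"
      using memD[OF g] D_iff sumD[OF g] by (intro carrierI) (auto simp: sum_negf)
    moreover have "?h \<otimes>\<^bsub>Gmax a\<^esub> g = \<one>\<^bsub>Gmax a\<^esub>"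
      by (auto simp: Gmax_def frac_add intro!: restrict_ext)
    ultimately show "\<exists>h\<in>carrier (Gmax a). h \<otimes>\<^bsub>Gmax a\<^esub> g = \<one>\<^bsub>Gmax a\<^esub>" by blast
  qed
qed

definition G0 :: "(nat \<Rightarrow> nat) \<Rightarrow> (nat \<Rightarrow> rat) set" where
  "G0 a = generate (Gmax a) {\<lambda>i\<in>{1..5}. 1 / of_nat (a i)}"

definition dual_group :: "(nat \<Rightarrow> nat) \<Rightarrow> (nat \<Rightarrow> rat) set \<Rightarrow> (nat \<Rightarrow> rat) set" where
  "dual_group a G =
    {g' \<in> carrier (Gmax a). \<forall>g\<in>G. (\<Sum>i\<in>{1..5}. g i * of_nat (a i) * g' i) \<in> \<int>}"

definition level :: "(nat \<Rightarrow> rat) \<Rightarrow> rat" where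
  "level g = (\<Sum>i\<in>{1..5}. g i)"

text \<open>
  \<open>deformations a G\<^sup>T\<close> is \<open>S\<^sup>G\<close> and \<open>deformations a G\<close> is the set \<open>S\<close> with superscript \<open>G\<^sup>T\<close>:
  the argument \<open>K\<close> is the group in which the exponents have to lie.
\<close>

definition deformations :: "(nat \<Rightarrow> nat) \<Rightarrow> (nat \<Rightarrow> rat) set \<Rightarrow> (nat \<Rightarrow> int) set" where
  "deformations a K =
    {S \<in> (\<Pi>\<^sub>E i\<in>{1..5}. {0..int (a i) - 2}).
       (\<Sum>i\<in>{1..5}. of_int (S i) / of_nat (a i) :: rat) = 1 \<and>
       (\<lambda>i\<in>{1..5}. of_int (S i) / of_nat (a i)) \<in> K}"

definition level_one_zeros :: "nat \<Rightarrow> (nat \<Rightarrow> rat) set \<Rightarrow> (nat \<Rightarrow> rat) set" where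
  "level_one_zeros n H = {z \<in> H. level z = 1 \<and> card {i \<in> {1..5}. z i = 0} = n}"

text \<open>\<open>Roan_pairs a H K\<close> is the set of \<open>(H, K)\<close>-Roan pairs.\<close>

definition Roan_pairs ::
  "(nat \<Rightarrow> nat) \<Rightarrow> (nat \<Rightarrow> rat) set \<Rightarrow> (nat \<Rightarrow> rat) set \<Rightarrow> ((nat \<Rightarrow> rat) \<times> (nat \<Rightarrow> rat)) set" where
  "Roan_pairs a H K =
    {(z, z') \<in> level_one_zeros 2 H \<times> level_one_zeros 3 K.
       (\<Sum>i\<in>{1..5}. z i * of_nat (a i) * z' i) = 0}"

text \<open>
  The second group argument is the mirror dual of the first: \<open>h21 a G G\<^sup>T\<close> is the Hodge number of
  \<open>W/G\<close>, and \<open>h21 a G\<^sup>T G\<close> that of \<open>W/G\<^sup>T\<close>.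
\<close>

definition h21 :: "(nat \<Rightarrow> nat) \<Rightarrow> (nat \<Rightarrow> rat) set \<Rightarrow> (nat \<Rightarrow> rat) set \<Rightarrow> nat" where
  "h21 a G G' = card (deformations a G') + card (Roan_pairs a G' G)"

definition Vafa_euler_char :: "(nat \<Rightarrow> nat) \<Rightarrow> (nat \<Rightarrow> rat) set \<Rightarrow> rat" where
  "Vafa_euler_char a G =
    1 / of_nat (card G) *
    (\<Sum>(g, h)\<in>G \<times> G. \<Prod>i\<in>{i \<in> {1..5}. g i = 0 \<and> h i = 0}. 1 - of_nat (a i))"

end

theory Submission
  imports Defs
begin

text \<open>
  Expanding each factor \<open>1 - a\<^sub>i\<close> of the Vafa formula into nontrivial characters and summing over
  \<open>h \<in> G\<close> turns \<open>\<chi>\<close> into the count of the pairs \<open>(g, g') \<in> G \<times> G\<^sup>T\<close> with complementary supports,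
  with sign \<open>(-1)\<^sup>n\<close>, where \<open>n\<close> is the number of zeros of \<open>g\<close>. Because levels are integers, only
  \<open>n \<in> {0, 2, 3, 5}\<close> occur. Negation makes the pairs of level one (for two or three zeros), or of
  level at most two (for full support), exactly half of all pairs. In the cases \<open>n = 2, 3\<close> these are
  the Roan pairs; an element of full support and level at most two is the generator
  \<open>(1/a\<^sub>1, \<dots>, 1/a\<^sub>5)\<close> of \<open>G\<^sub>0\<close>, or a deformation shifted by it. The two copies of the generator, in
  \<open>G\<close> and in \<open>G\<^sup>T\<close>, cancel.
\<close>

section \<open>Sums of characters\<close>

text \<open>If \<open>\<chi> y \<noteq> 1\<close> for some \<open>y\<close> in \<open>H\<close>,
  translation by \<open>y\<close> permutes \<open>H\<close> but multiplies the sum by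
  \<open>\<chi> y\<close>, so the sum vanishes.\<close>

lemma (in group) sum_character:
  fixes \<chi> :: "'a \<Rightarrow> 'c :: idom"
  assumes H: "subgroup H G"
    and mult: "\<And>x y. x \<in> H \<Longrightarrow> y \<in> H \<Longrightarrow> \<chi> (x \<otimes> y) = \<chi> x * \<chi> y"
  shows "(\<Sum>x\<in>H. \<chi> x) = (if \<forall>x\<in>H. \<chi> x = 1 then of_nat (card H) else 0)"
proof (cases "\<forall>x\<in>H. \<chi> x = 1")
  case False
  then obtain y where y: "y \<in> H" "\<chi> y \<noteq> 1" by blast
  have "bij_betw (\<lambda>x. y \<otimes> x) H H"
    by (rule bij_betw_byWitness[where f' = "\<lambda>x. inv y \<otimes> x"])
      (use H y in \<open>auto simp: subgroup.m_closed subgroup.m_inv_closed subgroup.mem_carrier m_assoc[symmetric]\<close>)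
  then have "(\<Sum>x\<in>H. \<chi> x) = (\<Sum>x\<in>H. \<chi> (y \<otimes> x))"
    by (rule sum.reindex_bij_betw[symmetric])
  also have "\<dots> = \<chi> y * (\<Sum>x\<in>H. \<chi> x)"
    using mult y by (simp add: sum_distrib_left)
  finally have "(1 - \<chi> y) * (\<Sum>x\<in>H. \<chi> x) = 0"
    by (simp add: algebra_simps)
  then show ?thesis using y False by auto
qed simp

text \<open>The standard character of \<rat>/\<int>; every character used below is its composition
  with a pairing.\<close>

definition rat_cis :: "rat \<Rightarrow> complex" where
  "rat_cis x = cis (2 * pi * of_rat x)"

lemma rat_cis_0 [simp]: "rat_cis 0 = 1"
  by (simp add: rat_cis_def)

lemma rat_cis_add: "rat_cis (x + y) = rat_cis x * rat_cis y"
  by (simp add: rat_cis_def cis_mult of_rat_add distrib_left)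

lemma rat_cis_sum: "rat_cis (\<Sum>i\<in>A. f i) = (\<Prod>i\<in>A. rat_cis (f i))"
  by (induction A rule: infinite_finite_induct) (simp_all add: rat_cis_add)

lemma rat_cis_of_nat_mult: "rat_cis (of_nat k * x) = rat_cis x ^ k"
  by (induction k) (simp_all add: rat_cis_add distrib_right)

lemma rat_cis_eq_1_iff: "rat_cis x = 1 \<longleftrightarrow> x \<in> \<int>"
proof
  assume "rat_cis x = 1"
  then have "cos (2 * pi * of_rat x) = 1"
    by (simp add: rat_cis_def complex_eq_iff)
  then obtain n :: int where "2 * pi * of_rat x = of_int n * 2 * pi"
    using cos_one_2pi_int by blast
  then have "(of_rat x :: real) = of_rat (of_int n)" by simp
  then have "x = of_int n" unfolding of_rat_eq_iff .
  then show "x \<in> \<int>" by simp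
next
  assume "x \<in> \<int>"
  then show "rat_cis x = 1"
    by (auto elim!: Ints_cases simp: rat_cis_def)
qed

lemma rat_cis_cong: "x - y \<in> \<int> \<Longrightarrow> rat_cis x = rat_cis y"
  using rat_cis_add[of y "x - y"] rat_cis_eq_1_iff[of "x - y"] by simp

lemma nonzero_fractions_eq_image:
  assumes "n > 0"
  shows "{x :: rat. 0 < x \<and> x < 1 \<and> x * of_nat n \<in> \<int>} = (\<lambda>k. of_nat k / of_nat n) ` {1..<n}"
proof (intro equalityI subsetI)
  fix x :: rat assume "x \<in> {x. 0 < x \<and> x < 1 \<and> x * of_nat n \<in> \<int>}"
  then have x: "0 < x" "x < 1" "x * of_nat n \<in> \<int>" by auto
  then obtain m where m: "x * of_nat n = of_int m" by (auto elim: Ints_cases)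
  have "0 < x * of_nat n" "x * of_nat n < of_nat n"
    using x assms by simp_all
  then have "(of_int 0 :: rat) < of_int m" "(of_int m :: rat) < of_int (int n)"
    unfolding m by simp_all
  then have "0 < m" "m < int n"
    unfolding of_int_less_iff .
  then show "x \<in> (\<lambda>k. of_nat k / of_nat n) ` {1..<n}"
    using m assms by (intro image_eqI[of _ _ "nat m"]) (simp_all add: eq_divide_eq nat_less_iff)
next
  fix x :: rat assume "x \<in> (\<lambda>k. of_nat k / of_nat n) ` {1..<n}"
  then obtain k where "x = of_nat k / of_nat n" "0 < k" "k < n" by auto
  then show "x \<in> {x. 0 < x \<and> x < 1 \<and> x * of_nat n \<in> \<int>}" by simp
qed

text \<open>With x = k/n the summand is the k-th power of \<open>rat_cis y\<close>, an n-th root of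
  unity. The geometric sum over all k < n is n or 0, and dropping k = 0 subtracts 1. The negated
  values 1 - n and 1 are the factors of the Vafa formula.\<close>

lemma sum_rat_cis_nonzero_fractions:
  assumes n: "n > 0" and y: "y * of_nat n \<in> \<int>"
  shows "(\<Sum>x | 0 < x \<and> x < 1 \<and> x * of_nat n \<in> \<int>. rat_cis (y * of_nat n * x)) =
    (if y \<in> \<int> then of_nat n - 1 else - 1)"
proof -
  have "(\<Sum>x | 0 < x \<and> x < 1 \<and> x * of_nat n \<in> \<int>. rat_cis (y * of_nat n * x)) =
      (\<Sum>k\<in>{1..<n}. rat_cis y ^ k)"
    unfolding nonzero_fractions_eq_image[OF n] using n
    by (subst sum.reindex)
      (auto simp: inj_on_def rat_cis_of_nat_mult[symmetric] mult.commute intro!: sum.cong)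
  also have "\<dots> = (\<Sum>k<n. rat_cis y ^ k) - 1"
    using n by (simp add: lessThan_atLeast0 sum.atLeast_Suc_lessThan)
  also have "\<dots> = (if y \<in> \<int> then of_nat n - 1 else - 1)"
  proof (cases "y \<in> \<int>")
    case True
    then show ?thesis using rat_cis_eq_1_iff[of y] by simp
  next
    case False
    moreover have "rat_cis y ^ n = 1"
      using y by (simp add: rat_cis_of_nat_mult[symmetric] rat_cis_eq_1_iff mult.commute)
    ultimately show ?thesis
      using rat_cis_eq_1_iff[of y] by (simp add: sum_gp_strict)
  qed
  finally show ?thesis .
qed

section \<open>Diagonal symmetries\<close>

definition pairing :: "(nat \<Rightarrow> nat) \<Rightarrow> (nat \<Rightarrow> rat) \<Rightarrow> (nat \<Rightarrow> rat) \<Rightarrow> rat" where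
  "pairing a g h = (\<Sum>i\<in>{1..5}. g i * of_nat (a i) * h i)"

text \<open>The inverse in \<open>Gmax a\<close>, in explicit coordinates so that its zeros and its
  level can be computed.\<close>

definition neg :: "(nat \<Rightarrow> rat) \<Rightarrow> nat \<Rightarrow> rat" where
  "neg g = (\<lambda>i\<in>{1..5}. frac (- g i))"

text \<open>The generator of \<open>G0 a\<close>; its level (age) is 1 because the reciprocals of
  the exponents sum to 1.\<close>

definition age_one :: "(nat \<Rightarrow> nat) \<Rightarrow> nat \<Rightarrow> rat" where
  "age_one a = (\<lambda>i\<in>{1..5}. 1 / of_nat (a i))"

definition zeros :: "(nat \<Rightarrow> rat) \<Rightarrow> nat set" where
  "zeros g = {i \<in> {1..5}. g i = 0}"

lemma zeros_subset: "zeros g \<subseteq> {1..5}"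
  by (auto simp: zeros_def)

lemma finite_zeros [simp]: "finite (zeros g)"
  by (simp add: zeros_def)

lemma card_Diff_zeros: "card ({1..5} - zeros g) = 5 - card (zeros g)"
  using card_Diff_subset[OF finite_zeros zeros_subset] by simp

lemma pairing_commute: "pairing a g h = pairing a h g"
  by (simp add: pairing_def mult.commute mult.left_commute)

lemma pairing_add_left: "pairing a (\<lambda>i. g i + h i) k = pairing a g k + pairing a h k"
  by (simp add: pairing_def sum.distrib distrib_right)

lemma pairing_minus_left: "pairing a (\<lambda>i. - g i) k = - pairing a g k"
  by (simp add: pairing_def sum_negf)

lemma dual_group_iff:
  "h \<in> dual_group a G \<longleftrightarrow> h \<in> carrier (Gmax a) \<and> (\<forall>g\<in>G. pairing a g h \<in> \<int>)"
  by (simp add: dual_group_def pairing_def)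

locale fermat_exponents =
  fixes a :: "nat \<Rightarrow> nat"
  assumes pos: "\<forall>i\<in>{1..5}. a i > 0"
    and sum_inverse: "(\<Sum>i\<in>{1..5}. 1 / of_nat (a i) :: rat) = 1"
begin

sublocale comm_group "Gmax a"
  by (rule comm_group_Gmax[OF pos])

text \<open>An exponent 1 would exhaust the sum of reciprocals, leaving nothing for the other four
  positive terms.\<close>

lemma exponent_gt_1:
  assumes i: "i \<in> {1..5}"
  shows "a i > 1"
proof (rule ccontr)
  assume "\<not> a i > 1"
  with pos i have ai: "a i = 1" by fastforce
  have "(\<Sum>i\<in>{1..5}. 1 / of_nat (a i) :: rat) =
      1 / of_nat (a i) + (\<Sum>i\<in>{1..5} - {i}. 1 / of_nat (a i))"
    using i by (intro sum.remove) auto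
  moreover have "(\<Sum>i\<in>{1..5} - {i}. 1 / of_nat (a i) :: rat) > 0"
  proof (rule sum_pos)
    have "card ({1..5} - {i}) = 4" using i by simp
    then show "{1..5} - {i} \<noteq> {}" by (metis card.empty zero_neq_numeral)
  qed (use pos in auto)
  ultimately show False using sum_inverse ai by simp
qed

lemma mem_carrier_iff:
  "g \<in> carrier (Gmax a) \<longleftrightarrow> g \<in> extensional {1..5} \<and>
    (\<forall>i\<in>{1..5}. 0 \<le> g i \<and> g i < 1 \<and> g i * of_nat (a i) \<in> \<int>) \<and> level g \<in> \<int>"
proof -
  have "x \<in> {of_nat k / of_nat (a i) | k. k < a i} \<longleftrightarrow> 0 \<le> x \<and> x < 1 \<and> x * of_nat (a i) \<in> \<int>"
    (is "?L x \<longleftrightarrow> ?R x") if i: "i \<in> {1..5}" for x :: rat and i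
  proof -
    have ai: "a i > 0" using pos i by blast
    show ?thesis
    proof (cases "x = 0")
      case True
      then show ?thesis using ai by (auto intro!: exI[of _ 0])
    next
      case False
      then have "?R x \<longleftrightarrow> x \<in> (\<lambda>k. of_nat k / of_nat (a i)) ` {1..<a i}"
        unfolding nonzero_fractions_eq_image[OF ai, symmetric] by auto
      also have "\<dots> \<longleftrightarrow> ?L x" using False by (fastforce simp: image_iff Suc_le_eq)
      finally show ?thesis by blast
    qed
  qed
  then show ?thesis
    unfolding Gmax_def level_def PiE_def Pi_def by auto
qed

lemma carrierD:
  assumes "g \<in> carrier (Gmax a)" "i \<in> {1..5}"
  shows "0 \<le> g i" "g i < 1" "g i * of_nat (a i) \<in> \<int>"
  using assms by (simp_all add: mem_carrier_iff)

lemma finite_carrier: "finite (carrier (Gmax a))"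
proof -
  have "finite {of_nat k / of_nat (a i) :: rat | k. k < a i}" for i by simp
  then have "finite (\<Pi>\<^sub>E i\<in>{1..5}. {of_nat k / of_nat (a i) :: rat | k. k < a i})"
    by (intro finite_PiE) auto
  then show ?thesis by (rule rev_finite_subset) (auto simp: Gmax_def)
qed

lemma finite_subgroup: "subgroup H (Gmax a) \<Longrightarrow> finite H"
  using finite_carrier subgroup.subset finite_subset by blast

lemma mult_Gmax: "g \<otimes>\<^bsub>Gmax a\<^esub> h = (\<lambda>i\<in>{1..5}. frac (g i + h i))"
  by (simp add: Gmax_def)

lemma one_Gmax: "\<one>\<^bsub>Gmax a\<^esub> = (\<lambda>i\<in>{1..5}. 0)"
  by (simp add: Gmax_def)

lemma carrier_ext:
  assumes "g \<in> carrier (Gmax a)" "h \<in> carrier (Gmax a)" "\<And>i. i \<in> {1..5} \<Longrightarrow> g i = h i"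
  shows "g = h"
  using assms by (intro extensionalityI[of g "{1..5}" h]) (simp_all add: mem_carrier_iff)

text \<open>Reduction modulo 1 subtracts integers from the coordinates, so it preserves integrality
  of the level.\<close>

lemma restrict_frac_in_carrier:
  assumes "\<And>i. i \<in> {1..5} \<Longrightarrow> f i * of_nat (a i) \<in> \<int>" "level f \<in> \<int>"
  shows "(\<lambda>i\<in>{1..5}. frac (f i)) \<in> carrier (Gmax a)"
proof -
  have "level (\<lambda>i\<in>{1..5}. frac (f i)) = level f - (\<Sum>i\<in>{1..5}. of_int \<lfloor>f i\<rfloor>)"
    by (simp add: level_def frac_def sum_subtractf)
  moreover have "(\<Sum>i\<in>{1..5}. of_int \<lfloor>f i\<rfloor> :: rat) \<in> \<int>" by (intro Ints_sum) simp
  moreover have "frac (f i) * of_nat (a i) \<in> \<int>" if "i \<in> {1..5}" for i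
    using assms(1)[OF that] by (simp add: frac_def left_diff_distrib)
  ultimately show ?thesis
    using assms(2) by (simp add: mem_carrier_iff frac_lt_1)
qed

lemma inv_Gmax:
  assumes g: "g \<in> carrier (Gmax a)"
  shows "inv\<^bsub>Gmax a\<^esub> g = neg g"
proof (rule inv_equality[OF _ g])
  show "neg g \<in> carrier (Gmax a)"
    unfolding neg_def using g
    by (intro restrict_frac_in_carrier) (auto simp: mem_carrier_iff level_def sum_negf)
  show "neg g \<otimes>\<^bsub>Gmax a\<^esub> g = \<one>\<^bsub>Gmax a\<^esub>"
    by (auto simp: neg_def mult_Gmax one_Gmax intro!: restrict_ext)
qed

lemma neg_closed: "subgroup H (Gmax a) \<Longrightarrow> g \<in> H \<Longrightarrow> neg g \<in> H"
  using subgroup.m_inv_closed subgroup.mem_carrier inv_Gmax by metis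

lemma neg_neg: "g \<in> carrier (Gmax a) \<Longrightarrow> neg (neg g) = g"
  using inv_inv inv_Gmax inv_closed by metis

lemma neg_apply:
  assumes "g \<in> carrier (Gmax a)" "i \<in> {1..5}"
  shows "neg g i = (if g i = 0 then 0 else 1 - g i)"
proof -
  have "frac (g i) = g i" using carrierD[OF assms] by (simp add: frac_eq)
  then show ?thesis using assms(2) frac_eq_0_iff[of "g i"] by (simp add: neg_def frac_neg)
qed

lemma zeros_neg:
  assumes g: "g \<in> carrier (Gmax a)"
  shows "zeros (neg g) = zeros g"
proof -
  have "neg g i = 0 \<longleftrightarrow> g i = 0" if "i \<in> {1..5}" for i
    using carrierD(2)[OF g that] neg_apply[OF g that] by auto
  then show ?thesis unfolding zeros_def by blast
qed

text \<open>Each nonzero coordinate x becomes 1 - x and zeros stay zero, so the two levels add up to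
  the size of the support.\<close>

lemma level_neg:
  assumes g: "g \<in> carrier (Gmax a)"
  shows "level (neg g) = of_nat (5 - card (zeros g)) - level g"
proof -
  have "level (neg g) = (\<Sum>i\<in>{1..5}. (if i \<in> {1..5} - zeros g then 1 else 0) - g i)"
    unfolding level_def by (intro sum.cong) (auto simp: neg_apply[OF g] zeros_def)
  also have "\<dots> = of_nat (card ({1..5} - zeros g)) - level g"
    unfolding sum_subtractf by (subst sum.inter_restrict[symmetric]) (auto simp: level_def Int_absorb1)
  finally show ?thesis
    unfolding card_Diff_zeros .
qed

lemma level_pos:
  assumes g: "g \<in> carrier (Gmax a)" and z: "card (zeros g) < 5"
  shows "level g > 0"
proof -
  have "zeros g \<noteq> {1..5}" using z by auto
  then obtain i where i: "i \<in> {1..5}" "g i \<noteq> 0" unfolding zeros_def by blast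
  then have "g i > 0" using carrierD(1)[OF g i(1)] by simp
  then show ?thesis
    unfolding level_def using i(1) carrierD(1)[OF g] by (intro sum_pos2[of _ i]) auto
qed

text \<open>This is positivity of the level of \<open>neg g\<close>, which has the same
  zeros.\<close>

lemma level_less:
  assumes g: "g \<in> carrier (Gmax a)" and z: "card (zeros g) < 5"
  shows "level g < of_nat (5 - card (zeros g))"
  using level_pos[of "neg g"] level_neg[OF g] inv_closed[OF g] z
  by (simp add: zeros_neg[OF g] inv_Gmax[OF g])

text \<open>The source of all restrictions on supports and levels: the level is an integer strictly
  between 0 and the size of the support.\<close>

lemma obtain_level:
  assumes g: "g \<in> carrier (Gmax a)" and z: "card (zeros g) < 5"
  obtains n where "level g = of_nat n" "0 < n" "n < 5 - card (zeros g)"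
proof -
  obtain m where m: "level g = of_int m"
    using g by (auto simp: mem_carrier_iff elim: Ints_cases)
  have "0 < m" using level_pos[OF g z] m by simp
  moreover have "m < int (5 - card (zeros g))"
    using level_less[OF g z] m by (metis of_int_less_iff of_int_of_nat_eq)
  ultimately show thesis using m by (intro that[of "nat m"]) auto
qed

lemma card_zeros_ne_4: "g \<in> carrier (Gmax a) \<Longrightarrow> card (zeros g) \<noteq> 4"
  by (rule notI, erule obtain_level) auto

lemma age_one_in_carrier: "age_one a \<in> carrier (Gmax a)"
  using exponent_gt_1 pos sum_inverse by (fastforce simp: mem_carrier_iff age_one_def level_def)

section \<open>The pairing modulo 1 and dual subgroups\<close>

lemma pairing_cong:
  assumes "\<And>i. i \<in> {1..5} \<Longrightarrow> h i * of_nat (a i) \<in> \<int>"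
    and "\<And>i. i \<in> {1..5} \<Longrightarrow> f i - g i \<in> \<int>"
  shows "pairing a f h - pairing a g h \<in> \<int>"
proof -
  \<comment> \<open>Each term is a product of two integers. Hence the pairing modulo 1 does not see
    the \<open>frac\<close> in group products and inverses.\<close>
  have "pairing a f h - pairing a g h = (\<Sum>i\<in>{1..5}. (f i - g i) * (h i * of_nat (a i)))"
    unfolding pairing_def sum_subtractf[symmetric] by (intro sum.cong refl) (simp add: algebra_simps)
  also have "\<dots> \<in> \<int>"
    using assms by (blast intro: Ints_sum Ints_mult[of "f _ - g _"])
  finally show ?thesis .
qed

lemma pairing_mult:
  assumes "h \<in> carrier (Gmax a)"
  shows "pairing a (f \<otimes>\<^bsub>Gmax a\<^esub> g) h - (pairing a f h + pairing a g h) \<in> \<int>"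
  unfolding pairing_add_left[symmetric]
  using carrierD(3)[OF assms] by (intro pairing_cong) (simp_all add: mult_Gmax frac_def)

lemma pairing_neg:
  assumes "h \<in> carrier (Gmax a)"
  shows "pairing a (neg g) h - (- pairing a g h) \<in> \<int>"
  unfolding pairing_minus_left[symmetric]
  using carrierD(3)[OF assms] by (intro pairing_cong) (simp_all add: neg_def frac_def)

text \<open>Thus integrality against the generator is the determinant condition. This puts the
  generator into every dual group, and gives integral levels to whatever pairs integrally with a
  group containing it.\<close>

lemma pairing_age_one: "pairing a (age_one a) g = level g"
  unfolding pairing_def level_def age_one_def using pos
  by (intro sum.cong refl) (fastforce simp: Suc_le_eq)

lemma Ints_diffD: "x - y \<in> \<int> \<Longrightarrow> y \<in> \<int> \<Longrightarrow> x \<in> \<int>" for x y :: rat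
  using Ints_add[of "x - y" y] by simp

lemma subgroup_dual_group:
  assumes G: "subgroup G (Gmax a)"
  shows "subgroup (dual_group a G) (Gmax a)"
proof (rule subgroupI)
  show "dual_group a G \<subseteq> carrier (Gmax a)" by (auto simp: dual_group_iff)
  have "\<one>\<^bsub>Gmax a\<^esub> \<in> dual_group a G"
    using one_closed by (auto simp: dual_group_iff one_Gmax pairing_def)
  then show "dual_group a G \<noteq> {}" by blast
next
  fix g h assume g: "g \<in> dual_group a G"
  show "inv\<^bsub>Gmax a\<^esub> g \<in> dual_group a G"
    using g inv_closed Ints_diffD[OF pairing_neg] subgroup.mem_carrier[OF G]
    by (auto simp: dual_group_iff inv_Gmax[symmetric] pairing_commute[of a _ "inv\<^bsub>Gmax a\<^esub> g"])
      (auto simp: inv_Gmax pairing_commute)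
  assume h: "h \<in> dual_group a G"
  show "g \<otimes>\<^bsub>Gmax a\<^esub> h \<in> dual_group a G"
    using g h Ints_diffD[OF pairing_mult] subgroup.mem_carrier[OF G]
    by (auto simp: dual_group_iff pairing_commute[of a _ "g \<otimes>\<^bsub>Gmax a\<^esub> h"])
      (auto simp: pairing_commute)
qed

lemma age_one_in_dual_group:
  "subgroup G (Gmax a) \<Longrightarrow> age_one a \<in> dual_group a G"
  using age_one_in_carrier subgroup.mem_carrier
  by (fastforce simp: dual_group_iff pairing_commute[of a _ "age_one a"] pairing_age_one mem_carrier_iff)

section \<open>The Vafa formula as a count of pairs with complementary supports\<close>

text \<open>
  The factor \<^term>\<open>1 - of_nat (a i)\<close> at \<open>h i = 0\<close>, and 1 otherwise, is minus the sum of the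
  nontrivial characters of \<open>\<int>/a\<^sub>i\<close>.
\<close>

lemma sum_prod_zeros:
  assumes G: "subgroup G (Gmax a)" and age: "age_one a \<in> G" and I: "I \<subseteq> {1..5}"
  shows "(\<Sum>h\<in>G. \<Prod>i\<in>{i \<in> I. h i = 0}. 1 - of_nat (a i) :: complex) =
    of_nat (card G) * ((-1) ^ card I * of_nat (card {g \<in> dual_group a G. zeros g = {1..5} - I}))"
proof -
  \<comment> \<open>Tuples in \<open>PiE {1..5} B\<close> are the candidates for dual elements with
    support exactly \<open>I\<close>; their level is not yet known to be integral.\<close>
  define B where "B i = (if i \<in> I then {x :: rat. 0 < x \<and> x < 1 \<and> x * of_nat (a i) \<in> \<int>} else {0})"
    for i
  have finI: "finite I" using I finite_subset by blast
  have finB: "finite (B i)" if "i \<in> {1..5}" for i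
    using nonzero_fractions_eq_image[of "a i"] pos that by (auto simp: B_def)
  have finP: "finite (PiE {1..5} B)" using finB by (intro finite_PiE) auto
  have expand: "(\<Prod>i\<in>{i \<in> I. h i = 0}. 1 - of_nat (a i) :: complex) =
      (-1) ^ card I * (\<Sum>g\<in>PiE {1..5} B. rat_cis (pairing a h g))" if "h \<in> G" for h
  proof -
    have h: "h \<in> carrier (Gmax a)" using subgroup.mem_carrier[OF G that] .
    have "(\<Prod>i\<in>{i \<in> I. h i = 0}. 1 - of_nat (a i) :: complex) =
        (\<Prod>i\<in>I. if h i = 0 then 1 - of_nat (a i) else 1)"
      by (rule prod.inter_filter[OF finI])
    also have "\<dots> = (\<Prod>i\<in>I. - (\<Sum>x\<in>B i. rat_cis (h i * of_nat (a i) * x)))"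
    proof (rule prod.cong[OF refl])
      fix i assume i: "i \<in> I"
      then have i5: "i \<in> {1..5}" using I by blast
      \<comment> \<open>The only integer in [0,1) is 0, so the case split of the character sum is
        the one of the Vafa factor.\<close>
      have "h i \<in> \<int> \<longleftrightarrow> h i = 0"
        using frac_eq_0_iff[of "h i"] carrierD[OF h i5] frac_eq[of "h i"] by auto
      then show "(if h i = 0 then 1 - of_nat (a i) else 1) =
          - (\<Sum>x\<in>B i. rat_cis (h i * of_nat (a i) * x))"
        using sum_rat_cis_nonzero_fractions[of "a i" "h i"] pos i5 carrierD(3)[OF h i5] i
        by (simp add: B_def)
    qed
    also have "\<dots> = (-1) ^ card I * (\<Prod>i\<in>I. \<Sum>x\<in>B i. rat_cis (h i * of_nat (a i) * x))"
      by (simp add: prod_uminus)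
    \<comment> \<open>Outside \<open>I\<close> the sum has the single term \<open>rat_cis 0\<close>,
      which is 1.\<close>
    also have "(\<Prod>i\<in>I. \<Sum>x\<in>B i. rat_cis (h i * of_nat (a i) * x)) =
        (\<Prod>i\<in>{1..5}. \<Sum>x\<in>B i. rat_cis (h i * of_nat (a i) * x))"
      using I by (intro prod.mono_neutral_left) (auto simp: B_def)
    also have "\<dots> = (\<Sum>g\<in>PiE {1..5} B. \<Prod>i\<in>{1..5}. rat_cis (h i * of_nat (a i) * g i))"
      using finB by (intro prod_sum_PiE) auto
    finally show ?thesis by (simp add: pairing_def rat_cis_sum)
  qed
  have dual: "{g \<in> PiE {1..5} B. \<forall>h\<in>G. pairing a h g \<in> \<int>} =
      {g \<in> dual_group a G. zeros g = {1..5} - I}" (is "?L = ?R")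
  proof (intro equalityI subsetI)
    fix g assume "g \<in> ?L"
    then have g: "g \<in> PiE {1..5} B" "\<And>h. h \<in> G \<Longrightarrow> pairing a h g \<in> \<int>" by auto
    have gi: "g i \<in> B i" if "i \<in> {1..5}" for i using g(1) that by auto
    \<comment> \<open>The generator lies in \<open>G\<close>, and pairing with it supplies the
      missing determinant condition.\<close>
    have "level g \<in> \<int>" using g(2)[OF age] by (simp add: pairing_age_one)
    moreover have "0 \<le> g i \<and> g i < 1 \<and> g i * of_nat (a i) \<in> \<int>" if "i \<in> {1..5}" for i
      using gi[OF that] by (auto simp: B_def less_imp_le split: if_splits)
    ultimately have "g \<in> carrier (Gmax a)"
      using g(1) by (simp add: mem_carrier_iff PiE_def)
    moreover have "g i = 0 \<longleftrightarrow> i \<notin> I" if "i \<in> {1..5}" for i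
      using gi[OF that] by (auto simp: B_def split: if_splits)
    then have "zeros g = {1..5} - I"
      unfolding zeros_def by blast
    ultimately show "g \<in> ?R" using g(2) by (simp add: dual_group_iff)
  next
    fix g assume "g \<in> ?R"
    then have g: "g \<in> carrier (Gmax a)" "\<And>h. h \<in> G \<Longrightarrow> pairing a h g \<in> \<int>" "zeros g = {1..5} - I"
      by (auto simp: dual_group_iff)
    have "g i \<in> B i" if "i \<in> {1..5}" for i
    proof -
      have "g i = 0 \<longleftrightarrow> i \<notin> I" using g(3) that unfolding zeros_def by blast
      then show ?thesis using carrierD[OF g(1) that] by (simp add: B_def less_le)
    qed
    then have "g \<in> PiE {1..5} B" using g(1) by (simp add: mem_carrier_iff PiE_def)
    then show "g \<in> ?L" using g(2) by blast
  qed
  \<comment> \<open>Every tuple, whatever its level, defines a character of \<open>G\<close>;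
    orthogonality keeps the tuples whose character is trivial.\<close>
  have orth: "(\<Sum>h\<in>G. rat_cis (pairing a h g)) =
      (if \<forall>h\<in>G. pairing a h g \<in> \<int> then of_nat (card G) else 0)" if "g \<in> PiE {1..5} B" for g
  proof -
    have "g i * of_nat (a i) \<in> \<int>" if "i \<in> {1..5}" for i
      using PiE_mem[OF \<open>g \<in> PiE {1..5} B\<close> that] by (auto simp: B_def split: if_splits)
    then have "pairing a (h \<otimes>\<^bsub>Gmax a\<^esub> k) g - (pairing a h g + pairing a k g) \<in> \<int>" for h k
      unfolding pairing_add_left[symmetric]
      by (intro pairing_cong) (simp_all add: mult_Gmax frac_def)
    then have "rat_cis (pairing a (h \<otimes>\<^bsub>Gmax a\<^esub> k) g) =
        rat_cis (pairing a h g) * rat_cis (pairing a k g)" for h k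
      using rat_cis_cong rat_cis_add by metis
    then show ?thesis
      using sum_character[OF G, of "\<lambda>h. rat_cis (pairing a h g)"]
      by (simp add: rat_cis_eq_1_iff)
  qed
  have "(\<Sum>h\<in>G. \<Prod>i\<in>{i \<in> I. h i = 0}. 1 - of_nat (a i) :: complex) =
      (-1) ^ card I * (\<Sum>g\<in>PiE {1..5} B. \<Sum>h\<in>G. rat_cis (pairing a h g))"
    by (simp add: expand sum_distrib_left[symmetric] sum.swap[of _ _ G])
  also have "(\<Sum>g\<in>PiE {1..5} B. \<Sum>h\<in>G. rat_cis (pairing a h g)) =
      (\<Sum>g\<in>{g \<in> PiE {1..5} B. \<forall>h\<in>G. pairing a h g \<in> \<int>}. of_nat (card G))"
    unfolding sum.inter_filter[OF finP] by (intro sum.cong refl orth)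
  finally show ?thesis unfolding dual by simp
qed

definition complementary_pairs ::
  "nat \<Rightarrow> (nat \<Rightarrow> rat) set \<Rightarrow> (nat \<Rightarrow> rat) set \<Rightarrow> ((nat \<Rightarrow> rat) \<times> (nat \<Rightarrow> rat)) set" where
  "complementary_pairs n H K =
    {(z, z') \<in> H \<times> K. zeros z' = {1..5} - zeros z \<and> card (zeros z) = n}"

text \<open>For fixed \<open>g\<close> the sum over \<open>h\<close> is
  \<open>sum_prod_zeros\<close> with \<open>I = zeros g\<close>. Its factor \<open>card G\<close>
  cancels the denominator, and the remaining sum over \<open>g\<close> is sorted by the number of
  zeros.\<close>

lemma Vafa_euler_char_eq_sum:
  assumes G: "subgroup G (Gmax a)" and age: "age_one a \<in> G"
  shows "Vafa_euler_char a G =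
    (\<Sum>n\<le>5. (-1) ^ n * of_nat (card (complementary_pairs n G (dual_group a G))))"
proof -
  let ?D = "dual_group a G"
  let ?N = "\<lambda>g. {g' \<in> ?D. zeros g' = {1..5} - zeros g}"
  have finG: "finite G" and finD: "finite ?D"
    using finite_subgroup G subgroup_dual_group by blast+
  have row: "(\<Sum>h\<in>G. \<Prod>i\<in>{i \<in> {1..5}. g i = 0 \<and> h i = 0}. 1 - of_nat (a i) :: rat) =
      of_nat (card G) * ((-1) ^ card (zeros g) * of_nat (card (?N g)))" (is "?x = ?y") for g
  proof -
    have eq: "{i \<in> {1..5}. g i = 0 \<and> h i = 0} = {i \<in> zeros g. h i = 0}" for h
      by (auto simp: zeros_def)
    \<comment> \<open>The character sum lives in the complex numbers; injectivity of
      \<open>of_rat\<close> brings the identity back to the rationals.\<close>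
    have "of_rat ?x = (of_rat ?y :: complex)"
      unfolding eq using sum_prod_zeros[OF G age zeros_subset[of g]]
      by (simp add: of_rat_sum of_rat_prod of_rat_diff of_rat_mult of_rat_power of_rat_minus)
    then show ?thesis unfolding of_rat_eq_iff .
  qed
  have "card G > 0" using subgroup.finite_imp_card_positive[OF G] finite_carrier by blast
  then have "Vafa_euler_char a G = (\<Sum>g\<in>G. (-1) ^ card (zeros g) * of_nat (card (?N g)))"
    unfolding Vafa_euler_char_def sum.cartesian_product[symmetric] row sum_distrib_left[symmetric]
    by simp
  also have "\<dots> = (\<Sum>n\<le>5. \<Sum>g\<in>{g \<in> G. card (zeros g) = n}. (-1) ^ card (zeros g) * of_nat (card (?N g)))"
    using finG card_mono[OF _ zeros_subset] by (intro sum.group[symmetric]) auto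
  also have "\<dots> = (\<Sum>n\<le>5. (-1) ^ n * of_nat (card (complementary_pairs n G ?D)))"
  proof (rule sum.cong[OF refl])
    fix n
    have "complementary_pairs n G ?D = Sigma {g \<in> G. card (zeros g) = n} ?N"
      by (auto simp: complementary_pairs_def)
    moreover have "finite {g \<in> G. card (zeros g) = n}" "finite (?N g)" for g
      using finG finD by auto
    ultimately show "(\<Sum>g\<in>{g \<in> G. card (zeros g) = n}. (-1) ^ card (zeros g) * of_nat (card (?N g))) =
        ((-1) ^ n * of_nat (card (complementary_pairs n G ?D)) :: rat)"
      by (simp add: card_SigmaI sum_distrib_left)
  qed
  finally show ?thesis .
qed

text \<open>Complementary zero sets have sizes \<open>n\<close> and \<open>5 - n\<close>, of
  opposite parity. Exchanging the groups therefore reverses the sign in the Euler characteristic,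
  which is how mirror symmetry enters.\<close>

lemma card_complementary_pairs_swap:
  assumes "n \<le> 5"
  shows "card (complementary_pairs n H K) = card (complementary_pairs (5 - n) K H)"
proof -
  note c = card_Diff_zeros
  have swap: "(y, x) \<in> complementary_pairs (5 - m) L' L"
    if "(x, y) \<in> complementary_pairs m L L'" for x y m L L'
    using that c[of x] zeros_subset[of x] by (auto simp: complementary_pairs_def)
  have "bij_betw (\<lambda>(x, y). (y, x)) (complementary_pairs n H K) (complementary_pairs (5 - n) K H)"
    using swap[of _ _ n H K] swap[of _ _ "5 - n" K H] assms
    by (intro bij_betw_byWitness[where f' = "\<lambda>(x, y). (y, x)"]) auto
  then show ?thesis by (rule bij_betw_same_card)
qed

text \<open>An element with four zeros would have an integral level strictly between 0 and
  1.\<close>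

lemma complementary_pairs_4:
  "H \<subseteq> carrier (Gmax a) \<Longrightarrow> complementary_pairs 4 H K = {}"
  using card_zeros_ne_4 by (auto simp: complementary_pairs_def)

section \<open>Levels and negation\<close>

lemma card_eq_double:
  assumes "finite A" "\<And>x. x \<in> A \<Longrightarrow> f x \<in> A" "\<And>x. x \<in> A \<Longrightarrow> f (f x) = x"
    and P: "\<And>x. x \<in> A \<Longrightarrow> P (f x) \<longleftrightarrow> \<not> P x"
  shows "card A = 2 * card {x \<in> A. P x}"
proof -
  have "bij_betw f {x \<in> A. P x} {x \<in> A. \<not> P x}"
    using assms by (intro bij_betw_byWitness[where f' = f]) auto
  then have "card {x \<in> A. P x} = card {x \<in> A. \<not> P x}" by (rule bij_betw_same_card)
  moreover have "card A = card {x \<in> A. P x} + card {x \<in> A. \<not> P x}"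
    using assms(1) by (subst card_Un_disjoint[symmetric]) (auto intro: arg_cong[where f = card])
  ultimately show ?thesis by simp
qed

text \<open>Only the first component is negated: it has three nonzero coordinates, so its level is 1
  or 2 and negation exchanges these. The second has two nonzero coordinates and is of level one
  automatically.\<close>

lemma card_complementary_pairs_2:
  assumes H: "subgroup H (Gmax a)" and K: "subgroup K (Gmax a)"
  shows "card (complementary_pairs 2 H K) = 2 * card (Roan_pairs a H K)"
proof -
  have fin: "finite (complementary_pairs 2 H K)"
    using finite_subgroup[OF H] finite_subgroup[OF K]
    by (auto simp: complementary_pairs_def intro: finite_subset[of _ "H \<times> K"])
  have "card (complementary_pairs 2 H K) =
      2 * card {p \<in> complementary_pairs 2 H K. level (fst p) = 1}"
  proof (rule card_eq_double[where f = "\<lambda>(z, z'). (neg z, z')", OF fin])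
    fix p assume p: "p \<in> complementary_pairs 2 H K"
    then have z: "fst p \<in> H" "card (zeros (fst p)) = 2"
      by (auto simp: complementary_pairs_def)
    then have zc: "fst p \<in> carrier (Gmax a)" using subgroup.mem_carrier[OF H] by blast
    show "(case p of (z, z') \<Rightarrow> (neg z, z')) \<in> complementary_pairs 2 H K"
      using p neg_closed[OF H z(1)] zeros_neg[OF zc] by (auto simp: complementary_pairs_def)
    show "(case case p of (z, z') \<Rightarrow> (neg z, z') of (z, z') \<Rightarrow> (neg z, z')) = p"
      using neg_neg[OF zc] by (auto split: prod.splits)
    obtain n where "level (fst p) = of_nat n" "0 < n" "n < 3"
      using obtain_level[OF zc] z by auto
    then have "level (fst p) = 1 \<or> level (fst p) = 2" by (auto simp: numeral_3_eq_3 less_Suc_eq)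
    then show "(level (fst (case p of (z, z') \<Rightarrow> (neg z, z'))) = 1) \<longleftrightarrow> level (fst p) \<noteq> 1"
      using level_neg[OF zc] z by (auto split: prod.splits)
  qed
  also have "{p \<in> complementary_pairs 2 H K. level (fst p) = 1} = Roan_pairs a H K"
  proof -
    \<comment> \<open>The case split isolates the conditions common to both sides, leaving a
      comparison of the conditions on \<open>zeros z'\<close>.\<close>
    have "(z, z') \<in> complementary_pairs 2 H K \<and> level z = 1 \<longleftrightarrow> (z, z') \<in> Roan_pairs a H K" for z z'
    proof (cases "z \<in> H \<and> z' \<in> K \<and> card (zeros z) = 2 \<and> level z = 1")
      case True
      then have zc: "z \<in> carrier (Gmax a)" "z' \<in> carrier (Gmax a)"
        using subgroup.mem_carrier[OF H] subgroup.mem_carrier[OF K] by simp_all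
      have c: "card ({1..5} - zeros z) = 3" unfolding card_Diff_zeros using True by simp
      have lev: "level z' = 1" if three: "card (zeros z') = 3"
      proof -
        obtain n where "level z' = of_nat n" "0 < n" "n < 5 - card (zeros z')"
          using obtain_level[OF zc(2)] three by auto
        then show ?thesis using three by (cases "n = 1") auto
      qed
      \<comment> \<open>All terms are nonnegative, so a zero pairing means disjoint supports. Having
        three zeros then forces the supports to be complementary.\<close>
      have "pairing a z z' = 0 \<longleftrightarrow> (\<forall>i\<in>{1..5}. z i * of_nat (a i) * z' i = 0)"
        unfolding pairing_def
        using carrierD(1)[OF zc(1)] carrierD(1)[OF zc(2)]
        by (intro sum_nonneg_eq_0_iff finite_atLeastAtMost mult_nonneg_nonneg of_nat_0_le_iff)
      also have "\<dots> \<longleftrightarrow> (\<forall>i\<in>{1..5}. z i = 0 \<or> z' i = 0)"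
      proof (intro ball_cong refl)
        fix i :: nat assume "i \<in> {1..5}"
        then have "a i > 0" using pos by blast
        then show "z i * of_nat (a i) * z' i = 0 \<longleftrightarrow> z i = 0 \<or> z' i = 0" by simp
      qed
      also have "\<dots> \<longleftrightarrow> {1..5} - zeros z \<subseteq> zeros z'"
        unfolding zeros_def by blast
      finally have "zeros z' = {1..5} - zeros z \<longleftrightarrow> card (zeros z') = 3 \<and> pairing a z z' = 0"
        using c subset_refl card_subset_eq[OF finite_zeros[of z'], of "{1..5} - zeros z"] by metis
      moreover have "(z, z') \<in> complementary_pairs 2 H K \<longleftrightarrow> zeros z' = {1..5} - zeros z"
        using True by (simp add: complementary_pairs_def)
      moreover have "(z, z') \<in> Roan_pairs a H K \<longleftrightarrow> card (zeros z') = 3 \<and> pairing a z z' = 0"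
        unfolding Roan_pairs_def level_one_zeros_def zeros_def[symmetric] pairing_def[symmetric]
        using True lev by auto
      ultimately show ?thesis using True by blast
    next
      case False
      then show ?thesis
        unfolding complementary_pairs_def Roan_pairs_def level_one_zeros_def zeros_def[symmetric]
        by auto
    qed
    then show ?thesis
      unfolding set_eq_iff split_paired_All mem_Collect_eq fst_conv by blast
  qed
  finally show ?thesis .
qed

section \<open>Elements of full support: deformations and the generator\<close>

lemma card_deformations:
  assumes H: "subgroup H (Gmax a)" and age: "age_one a \<in> H"
  shows "card (deformations a H) = card {g \<in> H. zeros g = {} \<and> level g = 2}" (is "_ = card ?F")
proof (rule bij_betw_same_card)
  have ai: "of_nat (a i) > (1 :: rat)" if "i \<in> {1..5}" for i
    using exponent_gt_1[OF that] by simp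
  \<comment> \<open>Multiplication by the generator raises the level from 1 to 2 and moves the
    numerators from 0..a_i - 2 to 1..a_i - 1, which is full support. In the inverse map the floor
    only turns an integral rational into an integer.\<close>
  show "bij_betw (\<lambda>S. \<lambda>i\<in>{1..5}. (of_int (S i) + 1) / of_nat (a i)) (deformations a H) ?F"
  proof (rule bij_betw_byWitness[where f' = "\<lambda>g. \<lambda>i\<in>{1..5}. \<lfloor>g i * of_nat (a i)\<rfloor> - 1"]; safe?)
    fix S assume "S \<in> deformations a H"
    then have S: "S \<in> extensional {1..5}" "\<And>i. i \<in> {1..5} \<Longrightarrow> 0 \<le> S i \<and> S i \<le> int (a i) - 2"
        "(\<Sum>i\<in>{1..5}. of_int (S i) / of_nat (a i) :: rat) = 1"
        "(\<lambda>i\<in>{1..5}. of_int (S i) / of_nat (a i)) \<in> H"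
      by (auto simp: deformations_def PiE_def Pi_def)
    let ?g = "\<lambda>i\<in>{1..5}. (of_int (S i) + 1) / of_nat (a i) :: rat"
    show "(\<lambda>i\<in>{1..5}. \<lfloor>?g i * of_nat (a i)\<rfloor> - 1) = S"
      using S(1) ai by (intro extensionalityI[of _ "{1..5}"]) (fastforce simp: floor_add_int)+
    \<comment> \<open>The bound a_i - 2 prevents wrap-around, so the shifted tuple is literally a
      product in \<open>Gmax a\<close>.\<close>
    have bnd: "0 \<le> (of_int (S i) + 1) / (of_nat (a i) :: rat) \<and> (of_int (S i) + 1) / (of_nat (a i) :: rat) < 1"
      if "i \<in> {1..5}" for i
    proof -
      have "of_int (S i) + 1 < (of_int (int (a i)) :: rat)" "0 \<le> (of_int (S i) :: rat)"
        using S(2)[OF that] by (simp_all del: of_int_of_nat_eq)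
      then show ?thesis using ai[OF that] by simp
    qed
    have "(\<lambda>i\<in>{1..5}. of_int (S i) / of_nat (a i)) \<otimes>\<^bsub>Gmax a\<^esub> age_one a = ?g"
      unfolding mult_Gmax age_one_def using bnd
      by (intro restrict_ext) (simp add: add_divide_distrib frac_eq)
    then show "?g \<in> H" using subgroup.m_closed[OF H S(4) age] by simp
    show "x \<in> {}" if "x \<in> zeros ?g" for x
    proof -
      have "(of_int (S x) + 1 :: rat) > 0" "of_nat (a x) > (1 :: rat)" "x \<in> {1..5}"
        using S(2)[of x] ai[of x] that zeros_subset by (force simp: zeros_def)+
      then show ?thesis using that by (auto simp: zeros_def)
    qed
    show "level ?g = 2"
      using S(3) sum_inverse by (simp add: level_def add_divide_distrib sum.distrib)
  next
    fix g assume g: "g \<in> H" "zeros g = {}" "level g = 2"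
    then have gc: "g \<in> carrier (Gmax a)" using subgroup.mem_carrier[OF H] by blast
    let ?S = "\<lambda>i\<in>{1..5}. \<lfloor>g i * of_nat (a i)\<rfloor> - 1"
    have fl: "of_int \<lfloor>g i * of_nat (a i)\<rfloor> = g i * of_nat (a i)" if "i \<in> {1..5}" for i
      using carrierD(3)[OF gc that] by (auto elim!: Ints_cases)
    show "(\<lambda>i\<in>{1..5}. (of_int (?S i) + 1) / of_nat (a i)) = g"
    proof (rule extensionalityI)
      show "g \<in> extensional {1..5}" using gc by (simp add: mem_carrier_iff)
      fix i :: nat assume i: "i \<in> {1..5}"
      show "(\<lambda>i\<in>{1..5}. (of_int (?S i) + 1) / of_nat (a i)) i = g i"
        using ai[OF i] i by (simp add: fl[OF i])
    qed (rule restrict_extensional)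
    have Sa: "of_int (?S i) / of_nat (a i) = g i - 1 / of_nat (a i)" if "i \<in> {1..5}" for i
      using ai[OF that] that by (simp add: fl[OF that] diff_divide_distrib)
    have range: "0 \<le> ?S i \<and> ?S i \<le> int (a i) - 2" if i: "i \<in> {1..5}" for i
    proof -
      have "g i > 0" using carrierD(1)[OF gc i] g(2) i by (auto simp: zeros_def less_le)
      obtain m where m: "g i * of_nat (a i) = of_int m"
        using carrierD(3)[OF gc i] by (auto elim: Ints_cases)
      have "0 < g i * of_nat (a i)" "g i * of_nat (a i) < of_int (int (a i))"
        using \<open>g i > 0\<close> carrierD(2)[OF gc i] ai[OF i] by simp_all
      then have "0 < m" "m < int (a i)" unfolding m of_int_less_iff of_int_0_less_iff .
      then show ?thesis using i by (simp add: m)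
    qed
    \<comment> \<open>Again nothing wraps around: by full support every coordinate of
      \<open>g\<close> is at least 1/a_i.\<close>
    have "(\<lambda>i\<in>{1..5}. of_int (?S i) / of_nat (a i)) = g \<otimes>\<^bsub>Gmax a\<^esub> neg (age_one a)"
      unfolding mult_Gmax
    proof (rule restrict_ext)
      fix i :: nat assume i: "i \<in> {1..5}"
      have "0 \<le> (of_int (?S i) / of_nat (a i) :: rat)" using range[OF i] by simp
      then have "0 \<le> g i - 1 / of_nat (a i)" unfolding Sa[OF i] .
      moreover have "g i - 1 / of_nat (a i) < 1"
        using carrierD(2)[OF gc i] zero_le_divide_1_iff[of "of_nat (a i) :: rat"] by linarith
      ultimately have "frac (g i - 1 / of_nat (a i)) = g i - 1 / of_nat (a i)"
        by (simp add: frac_eq)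
      then show "of_int (?S i) / of_nat (a i) = frac (g i + neg (age_one a) i)"
        unfolding Sa[OF i] using i by (simp add: neg_def age_one_def)
    qed
    then have "(\<lambda>i\<in>{1..5}. of_int (?S i) / of_nat (a i)) \<in> H"
      using subgroup.m_closed[OF H g(1) neg_closed[OF H age]] by simp
    moreover have "(\<Sum>i\<in>{1..5}. of_int (?S i) / of_nat (a i) :: rat) = 1"
    proof -
      have "(\<Sum>i\<in>{1..5}. of_int (?S i) / of_nat (a i) :: rat) = (\<Sum>i\<in>{1..5}. g i - 1 / of_nat (a i))"
        by (intro sum.cong refl Sa)
      then show ?thesis using g(3) sum_inverse by (simp add: sum_subtractf level_def)
    qed
    moreover have "?S \<in> (\<Pi>\<^sub>E i\<in>{1..5}. {0..int (a i) - 2})"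
    proof (rule PiE_I)
      show "?S i \<in> {0..int (a i) - 2}" if "i \<in> {1..5}" for i
        using range[OF that] unfolding atLeastAtMost_iff .
    qed auto
    ultimately show "?S \<in> deformations a H"
      unfolding deformations_def by (intro CollectI conjI)
  qed
qed

text \<open>A nonzero coordinate is at least 1/a_i, and these minimal values already sum to 1, so no
  coordinate can exceed its minimum.\<close>

lemma full_support_level_one:
  assumes g: "g \<in> carrier (Gmax a)" "zeros g = {}" "level g = 1"
  shows "g = age_one a"
proof (rule carrier_ext[OF g(1) age_one_in_carrier])
  have ge: "g i - 1 / of_nat (a i) \<ge> 0" if i: "i \<in> {1..5}" for i
  proof -
    obtain m where m: "g i * of_nat (a i) = of_int m"
      using carrierD(3)[OF g(1) i] by (auto elim: Ints_cases)
    have ai: "(of_nat (a i) :: rat) > 0" using pos i by auto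
    have "g i > 0" using carrierD(1)[OF g(1) i] g(2) i by (auto simp: zeros_def less_le)
    then have "g i * of_nat (a i) > 0" using ai by simp
    then have "g i * of_nat (a i) \<ge> 1" unfolding m by simp
    then show ?thesis using ai by (simp add: field_simps)
  qed
  have "(\<Sum>i\<in>{1..5}. g i - 1 / of_nat (a i)) = 0"
    using g(3) sum_inverse by (simp add: level_def sum_subtractf)
  then show "g i = age_one a i" if "i \<in> {1..5}" for i
    using ge that sum_nonneg_eq_0_iff[of "{1..5}" "\<lambda>i. g i - 1 / of_nat (a i)"]
    by (simp add: age_one_def)
qed

text \<open>The second component has five zeros and is the identity. On full support negation sends
  level l to 5 - l, exchanging {1, 2} with {3, 4}; level 1 is the generator and level 2 the shifted
  deformations.\<close>

lemma card_complementary_pairs_0: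
  assumes H: "subgroup H (Gmax a)" and age: "age_one a \<in> H" and K: "subgroup K (Gmax a)"
  shows "card (complementary_pairs 0 H K) = 2 * (1 + card (deformations a H))"
proof -
  let ?A = "{g \<in> H. zeros g = {}}"
  have fin: "finite ?A" using finite_subgroup[OF H] by simp
  have "zeros z' = {1..5} \<longleftrightarrow> z' = \<one>\<^bsub>Gmax a\<^esub>" if "z' \<in> K" for z'
  proof
    assume "zeros z' = {1..5}"
    then have "z' i = 0" if "i \<in> {1..5}" for i using that unfolding zeros_def by blast
    then show "z' = \<one>\<^bsub>Gmax a\<^esub>"
      using subgroup.mem_carrier[OF K \<open>z' \<in> K\<close>] one_closed by (intro carrier_ext) (simp_all add: one_Gmax)
  next
    assume "z' = \<one>\<^bsub>Gmax a\<^esub>"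
    then show "zeros z' = {1..5}" unfolding zeros_def one_Gmax by auto
  qed
  then have "complementary_pairs 0 H K = ?A \<times> {\<one>\<^bsub>Gmax a\<^esub>}"
    using subgroup.one_closed[OF K] by (auto simp: complementary_pairs_def)
  then have "card (complementary_pairs 0 H K) = card ?A"
    by (simp add: card_cartesian_product)
  also have "\<dots> = 2 * card {g \<in> ?A. level g \<le> 2}"
  proof (rule card_eq_double[where f = neg, OF fin])
    fix g assume "g \<in> ?A"
    then have g: "g \<in> H" "zeros g = {}" by auto
    then have gc: "g \<in> carrier (Gmax a)" using subgroup.mem_carrier[OF H] by blast
    show "neg g \<in> ?A" using neg_closed[OF H g(1)] zeros_neg[OF gc] g by simp
    show "neg (neg g) = g" by (rule neg_neg[OF gc])
    obtain n where "level g = of_nat n" using obtain_level[OF gc] g by auto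
    then show "level (neg g) \<le> 2 \<longleftrightarrow> \<not> level g \<le> 2"
      using level_neg[OF gc] g by (auto simp: not_le)
  qed
  also have "{g \<in> ?A. level g \<le> 2} = insert (age_one a) {g \<in> H. zeros g = {} \<and> level g = 2}"
  proof -
    have z: "zeros (age_one a) = {}" using pos by (auto simp: zeros_def age_one_def)
    have l: "level (age_one a) = 1" using sum_inverse by (simp add: level_def age_one_def)
    have "g = age_one a \<or> level g = 2" if g: "g \<in> H" "zeros g = {}" "level g \<le> 2" for g
    proof -
      have gc: "g \<in> carrier (Gmax a)" using subgroup.mem_carrier[OF H g(1)] .
      obtain n where n: "level g = of_nat n" "0 < n" using obtain_level[OF gc] g by auto
      then have "n = 1 \<or> n = 2" using g(3) by fastforce
      then show ?thesis using full_support_level_one[OF gc g(2)] n by auto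
    qed
    then show ?thesis using z l age by auto
  qed
  \<comment> \<open>The generator has level 1, so it is not among the elements of level 2.\<close>
  also have "card \<dots> = 1 + card (deformations a H)"
    using finite_subgroup[OF H] sum_inverse
    by (subst card_insert_disjoint) (auto simp: card_deformations[OF H age] level_def age_one_def)
  finally show ?thesis .
qed

end

theorem theorem5p2:
  fixes a :: "nat \<Rightarrow> nat" and G :: "(nat \<Rightarrow> rat) set"
  assumes "\<forall>i\<in>{1..5}. a i > 0"
    and "mono_on {1..5} a"
    and "(\<Sum>i\<in>{1..5}. 1 / of_nat (a i) :: rat) = 1"
    and "subgroup G (Gmax a)"
    and "G0 a \<subseteq> G"
  shows "1 / 2 * Vafa_euler_char a G =
    of_nat (h21 a (dual_group a G) G) - of_nat (h21 a G (dual_group a G))"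
proof -
  interpret fermat_exponents a using assms by unfold_locales
  let ?D = "dual_group a G"
  note G = \<open>subgroup G (Gmax a)\<close>
  note D = subgroup_dual_group[OF G]
  have age: "age_one a \<in> G"
    using assms(5) by (auto simp: G0_def age_one_def intro: generate.incl)
  have ageD: "age_one a \<in> ?D" by (rule age_one_in_dual_group[OF G])
  \<comment> \<open>Swapping turns n = 1, 3, 5 into n = 4, 2, 0 for the exchanged groups; the terms
    for 1 and 4 vanish. The constants 2 from n = 0 and n = 5 cancel, and halving leaves the
    difference of the Hodge numbers.\<close>
  have "{..5::nat} = {0, 1, 2, 3, 4, 5}" by auto
  then show ?thesis
    using card_complementary_pairs_swap[of 1 G ?D] card_complementary_pairs_swap[of 3 G ?D]
      card_complementary_pairs_swap[of 5 G ?D]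
    by (simp add: Vafa_euler_char_eq_sum[OF G age] complementary_pairs_4 subgroup.subset G D
        card_complementary_pairs_0[OF G age D] card_complementary_pairs_0[OF D ageD G]
        card_complementary_pairs_2[OF G D] card_complementary_pairs_2[OF D G] h21_def)
qed

end
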